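(* Let $n$ be a positive integer and let $a_0,a_j,b_j\in\mathbb{N}_0$, $c_j\in\mathbb{N}$ with $c_j\ge3$ for all $j\ge1$. Then $H_n^\star[\mathbf{s}]=\sum_{(\mathbf{p};\tilde{\mathbf{p}};\tilde{\tilde{\mathbf{p}}})\in\Pi(\mathbf{s})}\mathcal{H}_n[\mathbf{p};\tilde{\mathbf{p}};\tilde{\tilde{\mathbf{p}}}]$ in each of the following two cases. (A) $\ell\in\mathbb{N}$, $\mathbf{s}=(\{2\}^{b_1},c_1,\{2\}^{a_1},1,\dots,\{2\}^{b_\ell},c_\ell,\{2\}^{a_\ell},1)$, and $\Pi(\mathbf{s})=\{\overline{2b_1+2}\circ1^{\circ(c_1-3)}\circ\overline{2a_1+2}\circ\cdots\circ\overline{2b_\ell+2}\circ1^{\circ(c_\ell-3)}\circ\overline{2a_\ell+2};\ (b_1+1)\circ0^{\circ(c_1-3)}\circ(a_1+1)\circ\cdots\circ(b_\ell+1)\circ0^{\circ(c_\ell-3)}\circ(a_\ell+1);\ 1\circ\theta^{\circ(c_1-3)}\circ1\circ\big((-1)\circ\theta^{\circ(c_2-3)}\circ1\big)\circ\cdots\circ\big((-1)\circ\theta^{\circ(c_\ell-3)}\circ1\big)\}$, i.e. the third string is $1,\theta^{c_1-3},1$ followed, for each $j=2,\dots,\ell$, by the block $-1,\theta^{c_j-3},1$ (no such blocks if $\ell=1$). (B) $\ell\in\mathbb{N}_0$, $\mathbf{s}=(\{2\}^{a_0},1,\{2\}^{b_1},c_1,\{2\}^{a_1},1,\dots,\{2\}^{b_\ell},c_\ell,\{2\}^{a_\ell},1)$,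 and $\Pi(\mathbf{s})=\{(2a_0+1)\circ\overline{2b_1+2}\circ1^{\circ(c_1-3)}\circ\overline{2a_1+2}\circ\cdots\circ\overline{2b_\ell+2}\circ1^{\circ(c_\ell-3)}\circ\overline{2a_\ell+2};\ (a_0+1)\circ(b_1+1)\circ0^{\circ(c_1-3)}\circ(a_1+1)\circ\cdots\circ(b_\ell+1)\circ0^{\circ(c_\ell-3)}\circ(a_\ell+1);\ 2\circ\big((-1)\circ\theta^{\circ(c_1-3)}\circ1\big)\circ\cdots\circ\big((-1)\circ\theta^{\circ(c_\ell-3)}\circ1\big)\}$, i.e. the third string is $2$ followed, for each $j=1,\dots,\ell$, by the block $-1,\theta^{c_j-3},1$.
   Context: Fix $0<q<1$. $[k]=(1-q^k)/(1-q)$; $(x;q)_n=\prod_{i=0}^{n-1}(1-xq^i)$; $\binom{n}{k}_q=(q;q)_n/((q;q)_k(q;q)_{n-k})$ for $0\le k\le n$, else $0$. $\{x\}^a$ denotes $a$ copies of $x$. Signed numbers: $\mathbb{D}_0=\mathbb{N}_0\cup\{\bar k:k\in\mathbb{N}_0\}$ ($\bar k$ a formal symbol), $|k|=|\bar k|=k$, $\operatorname{sgn}(k)=1$, $\operatorname{sgn}(\bar k)=-1$; $a\oplus b=\overline{|a|+|b|}$ if exactly one of $a,b$ is unbarred, $a+b$ if both unbarred, $|a|+|b|$ if both barred. For $\mathbf{s}\in\mathbb{D}_0^m$: $H_n^\star[\mathbf{s}]=\sum_{n\ge k_1\ge\cdots\ge k_m\ge1}\prod_{j}\operatorname{sgn}(s_j)^{k_j}q^{k_j}/[k_j]^{|s_j|}$.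 $\theta$ is a formal symbol; $Q(r,k)=rk(k-1)/2$ if $r\in\mathbb{Z},r>0$; $Q(r,k)=rk(k-1)/2-k$ if $r\in\mathbb{Z},r\le0$; $Q(\theta,k)=0$. On $\mathbb{Z}\cup\{\theta\}$: $\theta\boxplus a=a\boxplus\theta=a$; $a\boxplus b=a+b$ for integers with $(a,b)\neq(1,-1),(-1,1)$; $1\boxplus(-1)=\theta$, $(-1)\boxplus1=0$; iterated $\boxplus$ evaluated left to right. For $\mathbf{s}\in\mathbb{D}_0^m$, $\mathbf{t}\in\mathbb{N}_0^m$, $\mathbf{r}\in(\mathbb{Z}\cup\{\theta\})^m$, $m\ge1$: $$\mathcal{H}_n[\mathbf{s};\mathbf{t};\mathbf{r}]=\sum_{n\ge k_1>\cdots>k_m\ge1}\frac{\binom{n}{k_1}_q}{\binom{n+k_1}{k_1}_q}\prod_{j=1}^m\frac{\operatorname{sgn}(s_j)^{k_j}q^{t_jk_j+Q(r_j,k_j)}(1+q^{k_j})}{[k_j]^{|s_j|}}.$$ Merging notation: the set $\{x_1\circ\cdots\circ x_N;y_1\circ\cdots\circ y_N;z_1\circ\cdots\circ z_N\}$ (three strings of the same length $N$) consists of the triples obtained from all $2^{N-1}$ choices, for each of the $N-1$ gaps, of a comma or a merge (same choice in all three strings); each maximal run of merged entries becomes one entry: its $\oplus$-sum in the first string, ordinary sum in the second, $\boxplus$-combination in the third; sums over such a set run over all $2^{N-1}$ choices. $x^{\circ k}$ means $k$ copies of $x$ separated by $\circ$ (empty if $k=0$, with the adjoining $\circ$ dropped).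 *)

theory Defs
  imports Complex_Main "HOL-Library.Multiset"
begin

definition qnum :: "real \<Rightarrow> nat \<Rightarrow> real" where
  "qnum q k = (1 - q ^ k) / (1 - q)"

definition qpoch :: "real \<Rightarrow> real \<Rightarrow> nat \<Rightarrow> real" where
  "qpoch x q n = (\<Prod>i<n. 1 - x * q ^ i)"

definition qbinom :: "real \<Rightarrow> nat \<Rightarrow> nat \<Rightarrow> real" where
  "qbinom q n k = (if k \<le> n then qpoch q q n / (qpoch q q k * qpoch q q (n - k)) else 0)"


datatype signed = Plain nat | Bar nat

fun sabs :: "signed \<Rightarrow> nat" where
  "sabs (Plain k) = k"
| "sabs (Bar k) = k"

fun ssgn :: "signed \<Rightarrow> real" where
  "ssgn (Plain k) = 1"
| "ssgn (Bar k) = -1"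

fun oplus :: "signed \<Rightarrow> signed \<Rightarrow> signed" where
  "oplus (Plain a) (Plain b) = Plain (a + b)"
| "oplus (Plain a) (Bar b) = Bar (a + b)"
| "oplus (Bar a) (Plain b) = Bar (a + b)"
| "oplus (Bar a) (Bar b) = Plain (a + b)"

definition Hstar :: "real \<Rightarrow> nat \<Rightarrow> signed list \<Rightarrow> real" where
  "Hstar q n s =
     (\<Sum>k | length k = length s \<and> set k \<subseteq> {1..n} \<and> sorted_wrt (\<ge>) k.
        \<Prod>j<length s. ssgn (s ! j) ^ (k ! j) * q ^ (k ! j) / qnum q (k ! j) ^ sabs (s ! j))"


text \<open>The set of integers extended by the formal symbol \<open>\<theta>\<close>.\<close>

datatype zth = Th | Z int

fun boxplus :: "zth \<Rightarrow> zth \<Rightarrow> zth" where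
  "boxplus Th y = y"
| "boxplus x Th = x"
| "boxplus (Z a) (Z b) = (if a = 1 \<and> b = -1 then Th else Z (a + b))"

text \<open>The divisions by 2 are exact.\<close>

fun Qexp :: "zth \<Rightarrow> nat \<Rightarrow> int" where
  "Qexp Th k = 0"
| "Qexp (Z r) k = (if r > 0 then r * int k * (int k - 1) div 2
                   else r * int k * (int k - 1) div 2 - int k)"

text \<open>Only used for \<open>s\<close>, \<open>t\<close>, \<open>r\<close> nonempty and of equal length.\<close>

definition Hcal :: "real \<Rightarrow> nat \<Rightarrow> signed list \<Rightarrow> nat list \<Rightarrow> zth list \<Rightarrow> real" where
  "Hcal q n s t r =
     (\<Sum>k | length k = length s \<and> set k \<subseteq> {1..n} \<and> sorted_wrt (>) k.
        qbinom q n (k ! 0) / qbinom q (n + k ! 0) (k ! 0) *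
        (\<Prod>j<length s.
           ssgn (s ! j) ^ (k ! j) * q powi (int (t ! j) * int (k ! j) + Qexp (r ! j) (k ! j))
             * (1 + q ^ (k ! j)) / qnum q (k ! j) ^ sabs (s ! j)))"


text \<open>
  The \<open>i\<close>-th boolean decides the \<open>i\<close>-th gap: \<open>True\<close> is a merge, \<open>False\<close> a comma.
  Each merged run is combined with \<open>f\<close> from left to right.
\<close>

fun merge :: "('a \<Rightarrow> 'a \<Rightarrow> 'a) \<Rightarrow> bool list \<Rightarrow> 'a list \<Rightarrow> 'a list" where
  "merge f (c # cs) (x # y # xs) =
     (if c then merge f cs (f x y # xs) else x # merge f cs (y # xs))"
| "merge f cs xs = xs"

text \<open>
  A multiset, because sums run over all choices for the gaps, even if two choices
  should lead to the same triple.
\<close>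

definition mergings ::
  "signed list \<Rightarrow> nat list \<Rightarrow> zth list \<Rightarrow> (signed list \<times> nat list \<times> zth list) multiset" where
  "mergings x y z =
     image_mset (\<lambda>cs. (merge oplus cs x, merge (+) cs y, merge boxplus cs z))
       (mset_set {cs. length cs = length x - 1})"


definition sblock :: "nat \<Rightarrow> nat \<Rightarrow> nat \<Rightarrow> signed list" where
  "sblock b c a = replicate b (Plain 2) @ [Plain c] @ replicate a (Plain 2) @ [Plain 1]"

definition xblock :: "nat \<Rightarrow> nat \<Rightarrow> nat \<Rightarrow> signed list" where
  "xblock b c a = [Bar (2 * b + 2)] @ replicate (c - 3) (Plain 1) @ [Bar (2 * a + 2)]"

definition yblock :: "nat \<Rightarrow> nat \<Rightarrow> nat \<Rightarrow> nat list" where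
  "yblock b c a = [b + 1] @ replicate (c - 3) 0 @ [a + 1]"

definition zblock :: "int \<Rightarrow> nat \<Rightarrow> zth list" where
  "zblock r c = [Z r] @ replicate (c - 3) Th @ [Z 1]"

definition sA :: "nat \<Rightarrow> (nat \<Rightarrow> nat) \<Rightarrow> (nat \<Rightarrow> nat) \<Rightarrow> (nat \<Rightarrow> nat) \<Rightarrow> signed list" where
  "sA l a b c = concat (map (\<lambda>j. sblock (b j) (c j) (a j)) [1..<l + 1])"

definition PiA :: "nat \<Rightarrow> (nat \<Rightarrow> nat) \<Rightarrow> (nat \<Rightarrow> nat) \<Rightarrow> (nat \<Rightarrow> nat)
    \<Rightarrow> (signed list \<times> nat list \<times> zth list) multiset" where
  "PiA l a b c = mergings
     (concat (map (\<lambda>j. xblock (b j) (c j) (a j)) [1..<l + 1]))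
     (concat (map (\<lambda>j. yblock (b j) (c j) (a j)) [1..<l + 1]))
     (zblock 1 (c 1) @ concat (map (\<lambda>j. zblock (-1) (c j)) [2..<l + 1]))"

definition sB :: "nat \<Rightarrow> (nat \<Rightarrow> nat) \<Rightarrow> (nat \<Rightarrow> nat) \<Rightarrow> (nat \<Rightarrow> nat) \<Rightarrow> signed list" where
  "sB l a b c = replicate (a 0) (Plain 2) @ [Plain 1]
     @ concat (map (\<lambda>j. sblock (b j) (c j) (a j)) [1..<l + 1])"

definition PiB :: "nat \<Rightarrow> (nat \<Rightarrow> nat) \<Rightarrow> (nat \<Rightarrow> nat) \<Rightarrow> (nat \<Rightarrow> nat)
    \<Rightarrow> (signed list \<times> nat list \<times> zth list) multiset" where
  "PiB l a b c = mergings
     ([Plain (2 * a 0 + 1)] @ concat (map (\<lambda>j. xblock (b j) (c j) (a j)) [1..<l + 1]))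
     ([a 0 + 1] @ concat (map (\<lambda>j. yblock (b j) (c j) (a j)) [1..<l + 1]))
     ([Z 2] @ concat (map (\<lambda>j. zblock (-1) (c j)) [1..<l + 1]))"

end

theory Submission
  imports Defs
begin

text \<open>
  Let \<open>B n k\<close> be the quotient of \<open>q\<close>-binomials in front of \<open>\<H>\<^sub>n\<close>, and call \<open>f\<close> a transform of \<open>h\<close>
  if \<open>h n = (\<Sum>k=1..n. B n k * f k)\<close> for all \<open>n\<close>. Prepending an entry to the string of a star sum
  multiplies \<open>h N\<close> by \<open>q ^ N / [N] ^ c\<close> and sums over \<open>N \<le> n\<close>; this acts on transforms as follows.
  For \<open>c = 2\<close> the identity \<open>q ^ n / [n]\<^sup>2 * B n k = q ^ k / [k]\<^sup>2 * (B n k - B (n - 1) k)\<close> shows that \<open>f k\<close>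
  is multiplied by \<open>q ^ k / [k]\<^sup>2\<close>. Multiplication and division of \<open>h n\<close> by \<open>[n]\<close> act by triangular
  matrices, found by telescoping (\<open>kernel_1\<close>, \<open>kernel_3\<close>), and this covers \<open>c = 1\<close> and \<open>c \<ge> 3\<close>. The
  diagonal of such a matrix produces a merge and its off-diagonal part a comma.
\<close>

section \<open>Triangular numbers and the exponents \<open>Qexp\<close>\<close>

definition tri :: "nat \<Rightarrow> nat" where
  "tri k = k * (k - 1) div 2"

lemma tri_0 [simp]: "tri 0 = 0"
  by (simp add: tri_def)

lemma tri_Suc [simp]: "tri (Suc k) = tri k + k"
proof (cases k)
  case (Suc m)
  have "Suc k * (Suc k - 1) = k * (k - 1) + k * 2"
    by (simp add: Suc)
  then show ?thesis
    unfolding tri_def by simp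
qed (simp add: tri_def)

lemma double_tri: "2 * int (tri k) = int k * (int k - 1)"
  by (induction k) (simp_all add: algebra_simps)

lemma Qexp_values:
  "Qexp (Z 2) k = 2 * int (tri k)"
  "Qexp (Z 1) k = int (tri k)"
  "Qexp (Z 0) k = - int k"
  "Qexp (Z (-1)) k = - int (tri k) - int k"
proof -
  have t: "int k * (int k - 1) = 2 * int (tri k)"
    by (simp add: double_tri)
  have "2 * int k * (int k - 1) = 2 * (2 * int (tri k))"
    using t by simp
  then show "Qexp (Z 2) k = 2 * int (tri k)"
    by simp
  show "Qexp (Z 1) k = int (tri k)"
    using t by simp
  have "(-1) * int k * (int k - 1) = 2 * (- int (tri k))"
    using t by simp
  then have "((-1) * int k * (int k - 1)) div 2 = - int (tri k)"
    by simp
  then show "Qexp (Z (-1)) k = - int (tri k) - int k"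
    by (simp only: Qexp.simps) simp
qed simp

section \<open>Sums over triangles, chains and gap choices\<close>

lemma sum_triangle_swap:
  fixes f :: "nat \<Rightarrow> nat \<Rightarrow> 'a::comm_monoid_add"
  shows "(\<Sum>j=1..n. \<Sum>k=1..<j. f j k) = (\<Sum>k=1..n. \<Sum>j=Suc k..n. f j k)"
proof (induction n)
  case (Suc n)
  have "(\<Sum>k=1..Suc n. \<Sum>j=Suc k..Suc n. f j k)
      = (\<Sum>k=1..n. (\<Sum>j=Suc k..n. f j k) + f (Suc n) k)"
    by simp
  also have "\<dots> = (\<Sum>k=1..n. \<Sum>j=Suc k..n. f j k) + (\<Sum>k=1..<Suc n. f (Suc n) k)"
    by (simp add: sum.distrib atLeastLessThanSuc_atLeastAtMost)
  finally show ?case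
    using Suc by (simp del: sum.op_ivl_Suc)
qed simp

text \<open>Peels off the largest index. \<open>u k = k\<close> serves the weak chains of
  \<open>Hstar\<close>, \<open>u k = k - 1\<close> the strict ones of \<open>Hcal\<close>; the
  latter bound describes \<open>k > j\<close> only for \<open>k \<ge> 1\<close>.\<close>

lemma sum_chain_Suc:
  fixes R :: "nat \<Rightarrow> nat \<Rightarrow> bool" and f :: "nat list \<Rightarrow> 'a::comm_monoid_add"
  assumes R: "\<And>k j. 1 \<le> k \<Longrightarrow> R k j \<longleftrightarrow> j \<le> u k" and u: "\<And>k. u k \<le> k"
  shows "(\<Sum>ks | length ks = Suc m \<and> set ks \<subseteq> {1..n} \<and> sorted_wrt R ks. f ks)
       = (\<Sum>k=1..n. \<Sum>ks | length ks = m \<and> set ks \<subseteq> {1..u k} \<and> sorted_wrt R ks. f (k # ks))"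
proof -
  let ?A = "\<lambda>m n. {ks. length ks = m \<and> set ks \<subseteq> {1..n} \<and> sorted_wrt R ks}"
  have "finite (?A m n)" for m n
    by (rule finite_subset[OF _ finite_lists_length_eq[of "{1..n}" m]]) auto
  then have "(\<Sum>k=1..n. \<Sum>ks\<in>?A m (u k). f (k # ks)) = (\<Sum>(k, ks)\<in>(SIGMA k:{1..n}. ?A m (u k)). f (k # ks))"
    by (intro sum.Sigma) auto
  also have "\<dots> = (\<Sum>ks\<in>?A (Suc m) n. f ks)"
  proof (rule sum.reindex_bij_witness[where i = "\<lambda>ks. (hd ks, tl ks)" and j = "\<lambda>(k, ks). k # ks"])
    fix p assume "p \<in> (SIGMA k:{1..n}. ?A m (u k))"
    then obtain k ks where p: "p = (k, ks)" "1 \<le> k" "k \<le> n" "ks \<in> ?A m (u k)"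
      by auto
    then have "\<forall>j\<in>set ks. 1 \<le> j \<and> j \<le> u k"
      by auto
    then show "(\<lambda>(k, ks). k # ks) p \<in> ?A (Suc m) n"
      using p R[OF p(2)] u[of k] by fastforce
  next
    fix ks assume "ks \<in> ?A (Suc m) n"
    then obtain k js where ks: "ks = k # js" "1 \<le> k" "k \<le> n" "length js = m"
        "set js \<subseteq> {1..n}" "\<forall>j\<in>set js. R k j" "sorted_wrt R js"
      by (cases ks) auto
    then show "(hd ks, tl ks) \<in> (SIGMA k:{1..n}. ?A m (u k))"
      using R[OF ks(2)] by auto
  next
    fix ks assume "ks \<in> ?A (Suc m) n"
    then show "(\<lambda>(k, ks). k # ks) (hd ks, tl ks) = ks"
      by (cases ks) auto
  qed auto
  finally show ?thesis by simp
qed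

lemma sum_bool_lists_Suc:
  fixes f :: "bool list \<Rightarrow> 'a::comm_monoid_add"
  shows "(\<Sum>cs | length cs = Suc m. f cs)
       = (\<Sum>cs | length cs = m. f (True # cs)) + (\<Sum>cs | length cs = m. f (False # cs))"
proof -
  have eq: "{cs. length cs = Suc m} = Cons True ` {cs. length cs = m} \<union> Cons False ` {cs. length cs = m}"
    by (auto simp: length_Suc_conv image_iff)
  have fin: "finite {cs :: bool list. length cs = m}"
    using finite_lists_length_eq[of "UNIV :: bool set" m] by simp
  show ?thesis
    unfolding eq by (subst sum.union_disjoint) (auto simp: fin sum.reindex)
qed

lemma merge_nonempty: "xs \<noteq> [] \<Longrightarrow> merge f cs xs \<noteq> []"
  by (induction f cs xs rule: merge.induct) auto

text \<open>With \<open>h\<close> a projection, the three strings can be merged as one string of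
  triples.\<close>

lemma map_merge:
  assumes "\<And>x y. h (f x y) = g (h x) (h y)"
  shows "map h (merge f cs xs) = merge g cs (map h xs)"
  using assms by (induction f cs xs rule: merge.induct) auto

text \<open>
  In every string of the theorem the entries \<open>1\<close> and \<open>-1\<close> alternate, up to \<open>\<theta>\<close>'s. Hence
  only six values occur as partial \<open>\<boxplus>\<close>-sums of a run. They are indexed by the next integer expected
  (\<open>b\<close> says that it is \<open>-1\<close>) and by a number \<open>i\<close> that stays constant along the run.
\<close>

fun st :: "bool \<Rightarrow> int \<Rightarrow> zth" where
  "st True i = Z i"
| "st False i = (if i = 1 then Th else Z (i - 1))"

fun alternating :: "bool \<Rightarrow> zth list \<Rightarrow> bool" where
  "alternating b [] = True"
| "alternating b (Th # zs) = alternating b zs"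
| "alternating b (Z r # zs) = (r = (if b then -1 else 1) \<and> alternating (\<not> b) zs)"

text \<open>\<open>r\<close> is 1 while the block stands first and -1 once an entry 1 is put in
  front of it.\<close>

definition triples :: "int \<Rightarrow> nat \<times> nat \<times> nat \<Rightarrow> (signed \<times> nat \<times> zth) list" where
  "triples r t = (case t of (b, c, a) \<Rightarrow>
     (Bar (2 * b + 2), b + 1, Z r) # replicate (c - 3) (Plain 1, 0, Th) @ [(Bar (2 * a + 2), a + 1, Z 1)])"

lemma triples_proj:
  "map fst (triples r (b, c, a)) = xblock b c a"
  "map (fst \<circ> snd) (triples r (b, c, a)) = yblock b c a"
  "map (snd \<circ> snd) (triples r (b, c, a)) = zblock r c"
  by (simp_all add: triples_def xblock_def yblock_def zblock_def)

lemma alternating_triples: "alternating True (map (snd \<circ> snd) (concat (map (triples (-1)) bs)))"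
proof (induction bs)
  case (Cons t bs)
  have "alternating False (replicate m Th @ Z 1 # map (snd \<circ> snd) (concat (map (triples (-1)) bs)))" for m
    using Cons by (induction m) simp_all
  then show ?case
    by (cases t) (simp add: triples_proj[unfolded o_def] zblock_def o_def)
qed simp

section \<open>The binomial quotient and its recurrences\<close>

locale unit_q =
  fixes q :: real
  assumes q_pos: "0 < q" and q_less_1: "q < 1"
begin

lemma q_nonzero [simp]: "q \<noteq> 0"
  using q_pos by simp

lemma q_power_less_1: "1 \<le> k \<Longrightarrow> q ^ k < 1"
  using q_pos q_less_1 by (simp add: power_less_one_iff)

lemma qnum_pos: "1 \<le> k \<Longrightarrow> 0 < qnum q k"
  using q_power_less_1[of k] q_less_1 by (simp add: qnum_def)

lemma qnum_nonzero [simp]: "1 \<le> k \<Longrightarrow> qnum q k \<noteq> 0"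
  using qnum_pos[of k] by simp

lemma qnum_diff: "qnum q n - qnum q k = (q ^ k - q ^ n) / (1 - q)"
  by (simp add: qnum_def diff_divide_distrib)

lemma qpoch_pos: "0 < qpoch q q n"
proof -
  have "0 < 1 - q * q ^ i" for i
    using q_power_less_1[of "Suc i"] by simp
  then show ?thesis
    unfolding qpoch_def by (intro prod_pos) auto
qed

lemma qpoch_nonzero [simp]: "qpoch q q n \<noteq> 0"
  using qpoch_pos[of n] by simp

lemma qpoch_Suc: "qpoch q q (Suc n) = qpoch q q n * (1 - q ^ Suc n)"
  by (simp add: qpoch_def)

definition B :: "nat \<Rightarrow> nat \<Rightarrow> real" where
  "B n k = qbinom q n k / qbinom q (n + k) k"

lemma B_eq: "k \<le> n \<Longrightarrow> B n k = qpoch q q n ^ 2 / (qpoch q q (n - k) * qpoch q q (n + k))"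
  by (simp add: B_def qbinom_def field_simps power2_eq_square)

lemma B_0 [simp]: "B n 0 = 1"
  by (simp add: B_eq power2_eq_square)

lemma B_eq_0 [simp]: "n < k \<Longrightarrow> B n k = 0"
  by (simp add: B_def qbinom_def)

lemma B_Suc_right:
  assumes "k < n"
  shows "B n k * (q ^ k - q ^ n) = q ^ k * B n (Suc k) * (1 - q ^ (n + Suc k))"
proof -
  \<comment> \<open>This replaces truncated differences: \<open>n - k = Suc d\<close> and
    \<open>n - Suc k = d\<close>.\<close>
  obtain d where d: "n = Suc k + d"
    using assms less_iff_Suc_add by auto
  have "B n k = qpoch q q n ^ 2 / (qpoch q q (Suc d) * qpoch q q (n + k))"
    using B_eq[of k n] d by simp
  moreover have "B n (Suc k) = qpoch q q n ^ 2 / (qpoch q q d * qpoch q q (Suc (n + k)))"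
    using B_eq[of "Suc k" n] d by simp
  moreover have "1 - q ^ Suc d \<noteq> 0" "1 - q ^ Suc (n + k) \<noteq> 0"
    using q_power_less_1[of "Suc d"] q_power_less_1[of "Suc (n + k)"] by simp_all
  moreover have "q ^ k - q ^ n = q ^ k * (1 - q ^ Suc d)"
    by (simp add: d power_add algebra_simps)
  ultimately show ?thesis
    by (simp add: qpoch_Suc del: power_Suc)
qed

lemma B_Suc_left:
  assumes "k \<le> Suc n"
  shows "q ^ k * B n k * (1 - q ^ Suc n) ^ 2
       = B (Suc n) k * (q ^ k - q ^ Suc n) * (1 - q ^ (Suc n + k))"
\<comment> \<open>At \<open>k = Suc n\<close> both sides vanish.\<close>
proof (cases "k = Suc n")
  case False
  then obtain d where d: "n = k + d"
    using assms le_iff_add by (metis le_SucE)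
  have "B n k = qpoch q q n ^ 2 / (qpoch q q d * qpoch q q (n + k))"
    using B_eq[of k n] d by simp
  moreover have "B (Suc n) k = qpoch q q (Suc n) ^ 2 / (qpoch q q (Suc d) * qpoch q q (Suc (n + k)))"
    using B_eq[of k "Suc n"] d by (simp add: Suc_diff_le)
  moreover have "1 - q ^ Suc d \<noteq> 0" "1 - q ^ Suc (n + k) \<noteq> 0"
    using q_power_less_1[of "Suc d"] q_power_less_1[of "Suc (n + k)"] by simp_all
  moreover have "q ^ k - q ^ Suc n = q ^ k * (1 - q ^ Suc d)"
    by (simp add: d power_add algebra_simps)
  ultimately show ?thesis
    by (simp add: qpoch_Suc power_mult_distrib del: power_Suc)
qed simp

text \<open>With \<open>u = q^k\<close> and \<open>v = q^Suc n\<close>, \<open>B_Suc_left\<close>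
  reduces this to \<open>u * (1 - v)^2 - (u - v) * (1 - v * u) = v * (1 - u)^2\<close>.\<close>

lemma B_diff:
  assumes "1 \<le> k" "k \<le> Suc n"
  shows "q ^ Suc n / qnum q (Suc n) ^ 2 * B (Suc n) k
       = q ^ k / qnum q k ^ 2 * (B (Suc n) k - B n k)"
proof -
  define u v where "u = q ^ k" and "v = q ^ Suc n"
  have uv: "u \<noteq> 1" "v \<noteq> 1" "1 - q \<noteq> 0"
    using q_power_less_1[of k] q_power_less_1[of "Suc n"] assms q_less_1
    by (simp_all add: u_def v_def del: power_Suc)
  have B: "u * B n k * (1 - v) ^ 2 = B (Suc n) k * (u - v) * (1 - v * u)"
    using B_Suc_left[OF assms(2)] unfolding u_def v_def power_add .
  have "u * (1 - v) ^ 2 * (B (Suc n) k - B n k)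
      = u * (1 - v) ^ 2 * B (Suc n) k - u * B n k * (1 - v) ^ 2"
    by (simp add: algebra_simps)
  also have "\<dots> = v * (1 - u) ^ 2 * B (Suc n) k"
    unfolding B by (simp add: algebra_simps power2_eq_square)
  finally have *: "v * (1 - u) ^ 2 * B (Suc n) k = u * (1 - v) ^ 2 * (B (Suc n) k - B n k)"
    by simp
  have "v / ((1 - v) / (1 - q)) ^ 2 * B (Suc n) k
      = (v * (1 - u) ^ 2 * B (Suc n) k) * ((1 - q) ^ 2 / ((1 - u) ^ 2 * (1 - v) ^ 2))"
    using uv by (simp add: power_divide)
  also have "\<dots> = u / ((1 - u) / (1 - q)) ^ 2 * (B (Suc n) k - B n k)"
    unfolding * using uv by (simp add: power_divide)
  finally show ?thesis
    by (simp add: qnum_def u_def v_def del: power_Suc)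
qed

section \<open>Transforms and the entry 2\<close>

definition S :: "nat \<Rightarrow> (nat \<Rightarrow> real) \<Rightarrow> real" where
  "S n f = (\<Sum>k=1..n. B n k * f k)"

lemma S_cong: "(\<And>k. 1 \<le> k \<Longrightarrow> f k = g k) \<Longrightarrow> S n f = S n g"
  by (simp add: S_def)

text \<open>By \<open>B_diff\<close> each new summand is a difference in the first argument of
  \<open>B\<close>, so the sum telescopes.\<close>

lemma sum_S_2: "(\<Sum>N=1..n. q ^ N / qnum q N ^ 2 * S N f) = S n (\<lambda>k. q ^ k / qnum q k ^ 2 * f k)"
proof (induction n)
  case (Suc n)
  let ?g = "\<lambda>k. q ^ k / qnum q k ^ 2 * f k"
  have "q ^ Suc n / qnum q (Suc n) ^ 2 * S (Suc n) f
      = (\<Sum>k=1..Suc n. (q ^ Suc n / qnum q (Suc n) ^ 2 * B (Suc n) k) * f k)"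
    unfolding S_def sum_distrib_left by (simp only: mult.assoc)
  also have "\<dots> = (\<Sum>k=1..Suc n. (B (Suc n) k - B n k) * ?g k)"
    by (rule sum.cong[OF refl], subst B_diff) auto
  also have "\<dots> = S (Suc n) ?g - (\<Sum>k=1..Suc n. B n k * ?g k)"
    unfolding S_def sum_subtractf[symmetric] by (simp only: left_diff_distrib)
  \<comment> \<open>The last term drops out since \<open>B n (Suc n) = 0\<close>.\<close>
  also have "(\<Sum>k=1..Suc n. B n k * ?g k) = S n ?g"
    by (simp add: S_def)
  finally show ?case
    using Suc by simp
qed (simp add: S_def)

text \<open>The operator has diagonal \<open>x\<close> and entries \<open>w j * y k\<close> below
  it. As these factor, swapping the sums leaves only tails of \<open>B n j * w j\<close>, which
  \<open>kernel_1\<close> and \<open>kernel_3\<close> evaluate.\<close>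

lemma S_triangular:
  "S n (\<lambda>j. x j * f j + w j * (\<Sum>k=1..<j. y k * f k))
     = (\<Sum>k=1..n. (B n k * x k + y k * (\<Sum>j=Suc k..n. B n j * w j)) * f k)"
proof -
  have "S n (\<lambda>j. x j * f j + w j * (\<Sum>k=1..<j. y k * f k))
      = (\<Sum>k=1..n. B n k * x k * f k) + (\<Sum>j=1..n. \<Sum>k=1..<j. B n j * w j * (y k * f k))"
    unfolding S_def by (simp add: sum.distrib sum_distrib_left algebra_simps)
  also have "\<dots> = (\<Sum>k=1..n. B n k * x k * f k) + (\<Sum>k=1..n. \<Sum>j=Suc k..n. B n j * w j * (y k * f k))"
    by (simp only: sum_triangle_swap)
  also have "\<dots> = (\<Sum>k=1..n. (B n k * x k + y k * (\<Sum>j=Suc k..n. B n j * w j)) * f k)"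
    by (simp add: sum.distrib sum_distrib_left sum_distrib_right algebra_simps)
  finally show ?thesis .
qed

section \<open>Multiplication by \<open>[n]\<close> and the entry 1\<close>

lemma kernel_1:
  assumes "k \<le> n"
  shows "q ^ (2 * tri k + k) * (qnum q n - qnum q k) * B n k
       = (\<Sum>j=Suc k..n. B n j * ((1 + q ^ j) * q ^ (2 * tri j) * qnum q j))"
  using assms
\<comment> \<open>Downwards from \<open>k = n\<close>, where both sides are 0; the step adds the
  term \<open>j = Suc k\<close>.\<close>
proof (induction k rule: inc_induct)
  case (step k)
  define Q p v where "Q = q ^ tri k" and "p = q ^ k" and "v = q ^ n"
  have B: "B n k * (p - v) = p * B n (Suc k) * (1 - v * (q * p))"
    using B_Suc_right[OF step(2)] by (simp add: p_def v_def power_add algebra_simps)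
  have P: "q ^ (2 * tri k + k) = Q ^ 2 * p"
      "q ^ (2 * tri (Suc k) + Suc k) = Q ^ 2 * p ^ 3 * q"
      "q ^ (2 * tri (Suc k)) = Q ^ 2 * p ^ 2" "q ^ Suc k = q * p"
    by (simp_all add: Q_def p_def power_add power_mult power_mult_distrib
        power2_eq_square power3_eq_cube mult_2)
  have "(\<Sum>j=Suc k..n. B n j * ((1 + q ^ j) * q ^ (2 * tri j) * qnum q j))
     = B n (Suc k) * ((1 + q ^ Suc k) * q ^ (2 * tri (Suc k)) * qnum q (Suc k))
       + q ^ (2 * tri (Suc k) + Suc k) * (qnum q n - qnum q (Suc k)) * B n (Suc k)"
    using step by (simp add: sum.atLeast_Suc_atMost del: tri_Suc power_Suc)
  \<comment> \<open>The terms with \<open>(q * p)^2\<close> cancel, which leaves the right-hand side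
    of \<open>B\<close>.\<close>
  also have "\<dots> = Q ^ 2 * p * (p * B n (Suc k) * (1 - v * (q * p))) / (1 - q)"
    unfolding qnum_diff P qnum_def v_def[symmetric]
    by (simp add: add_divide_distrib diff_divide_distrib power2_eq_square power3_eq_cube algebra_simps)
  also have "\<dots> = Q ^ 2 * p * (p - v) / (1 - q) * B n k"
    unfolding B[symmetric] by simp
  finally show ?case
    unfolding qnum_diff P by (simp add: p_def v_def)
qed simp

text \<open>As \<open>q^N / [N] = q^N / [N]^2 * [N]\<close>, multiplication by \<open>[N]\<close>
  through \<open>kernel_1\<close> is followed by \<open>sum_S_2\<close>.\<close>

lemma sum_S_1:
  "(\<Sum>N=1..n. q ^ N / qnum q N * S N f)
     = S n (\<lambda>j. q ^ j / qnum q j * f j + (1 + q ^ j) * (q ^ (j + 2 * tri j) / qnum q j)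
                * (\<Sum>k=1..<j. f k / q ^ (2 * tri k + k)))"
proof -
  let ?g = "\<lambda>j. qnum q j * f j + (1 + q ^ j) * q ^ (2 * tri j) * qnum q j
                * (\<Sum>k=1..<j. (1 / q ^ (2 * tri k + k)) * f k)"
  have *: "qnum q N * S N f = S N ?g" for N
  proof -
    have "B N k * qnum q k + 1 / q ^ (2 * tri k + k) *
        (\<Sum>j=Suc k..N. B N j * ((1 + q ^ j) * q ^ (2 * tri j) * qnum q j)) = qnum q N * B N k"
      if "k \<in> {1..N}" for k
      using that by (subst kernel_1[symmetric]) (auto simp: algebra_simps)
    then show ?thesis
      unfolding S_triangular unfolding S_def sum_distrib_left by (simp add: mult.assoc)
  qed
  have "(\<Sum>N=1..n. q ^ N / qnum q N * S N f) = (\<Sum>N=1..n. q ^ N / qnum q N ^ 2 * S N ?g)"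
    unfolding *[symmetric] by (rule sum.cong[OF refl]) (simp add: power2_eq_square)
  also have "\<dots> = S n (\<lambda>k. q ^ k / qnum q k ^ 2 * ?g k)"
    by (rule sum_S_2)
  also have "\<dots> = S n (\<lambda>j. q ^ j / qnum q j * f j + (1 + q ^ j) * (q ^ (j + 2 * tri j) / qnum q j)
                * (\<Sum>k=1..<j. f k / q ^ (2 * tri k + k)))"
    by (rule S_cong) (simp add: power_add power2_eq_square field_simps)
  finally show ?thesis .
qed

text \<open>The empty star sum 1 has no transform, as \<open>S 0 f = 0\<close>. The innermost entry
  1 is therefore treated by \<open>kernel_1\<close> at \<open>k = 0\<close>, where
  \<open>B n 0 = 1\<close> and \<open>[0] = 0\<close>.\<close>

lemma sum_1: "(\<Sum>N=1..n. q ^ N / qnum q N) = S n (\<lambda>j. (1 + q ^ j) * (q ^ (j + 2 * tri j) / qnum q j))"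
proof -
  let ?g = "\<lambda>j. (1 + q ^ j) * q ^ (2 * tri j) * qnum q j"
  have *: "qnum q N = S N ?g" for N
    using kernel_1[of 0 N] by (simp add: S_def qnum_def)
  have "(\<Sum>N=1..n. q ^ N / qnum q N) = (\<Sum>N=1..n. q ^ N / qnum q N ^ 2 * S N ?g)"
    by (rule sum.cong[OF refl]) (simp add: *[symmetric] power2_eq_square)
  also have "\<dots> = S n (\<lambda>k. q ^ k / qnum q k ^ 2 * ?g k)"
    by (rule sum_S_2)
  also have "\<dots> = S n (\<lambda>j. (1 + q ^ j) * (q ^ (j + 2 * tri j) / qnum q j))"
    by (rule S_cong) (simp add: power_add power2_eq_square field_simps)
  finally show ?thesis .
qed

section \<open>Division by \<open>[n]\<close> and the entries at least 3\<close>

definition D :: "nat \<Rightarrow> real" where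
  "D k = (-1) ^ k * q ^ tri k"

lemma D_nonzero [simp]: "D k \<noteq> 0"
  by (simp add: D_def)

text \<open>Proved downwards like \<open>kernel_1\<close>; the step rests on
  \<open>(1 + q * p) * (1 - v) - (q * p - v) = 1 - v * (q * p)\<close>.\<close>

lemma kernel_3:
  assumes "k \<le> n" "1 \<le> n"
  shows "D k * (qnum q k / qnum q n - 1) * B n k = (\<Sum>j=Suc k..n. B n j * (D j * (1 + q ^ j)))"
  using assms(1)
proof (induction k rule: inc_induct)
  case base
  then show ?case using assms by simp
next
  case (step k)
  define p v where "p = q ^ k" and "v = q ^ n"
  have v: "v \<noteq> 1" "1 - q \<noteq> 0"
    using q_power_less_1[OF assms(2)] q_less_1 by (simp_all add: v_def)
  have r: "qnum q i / qnum q n - 1 = - (q ^ i - v) / (1 - v)" for i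
    using v unfolding qnum_def v_def[symmetric] by (simp add: divide_simps)
  have B: "B n k * (p - v) = p * B n (Suc k) * (1 - v * (q * p))"
    using B_Suc_right[OF step(2)] by (simp add: p_def v_def power_add algebra_simps)
  have DS: "D (Suc k) = - D k * p"
    by (simp add: D_def p_def power_add)
  have "(\<Sum>j=Suc k..n. B n j * (D j * (1 + q ^ j)))
     = B n (Suc k) * (D (Suc k) * (1 + q ^ Suc k))
       + D (Suc k) * (qnum q (Suc k) / qnum q n - 1) * B n (Suc k)"
    using step by (simp add: sum.atLeast_Suc_atMost del: power_Suc)
  also have "\<dots> = - D k * (p * B n (Suc k) * (1 - v * (q * p))) / (1 - v)"
    unfolding r DS power_Suc p_def[symmetric] using v by (simp add: field_simps)
  also have "\<dots> = D k * (- (p - v) / (1 - v)) * B n k"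
    unfolding B[symmetric] by (simp add: algebra_simps)
  finally show ?case
    unfolding r p_def by simp
qed

text \<open>Division by \<open>[n]\<close> with the factors \<open>D\<close> stripped off: the first
  summand becomes the merge, the second the comma.\<close>

definition V :: "(nat \<Rightarrow> real) \<Rightarrow> nat \<Rightarrow> real" where
  "V f j = f j + (1 + q ^ j) * (\<Sum>k=1..<j. f k)"

lemma V_cong: "(\<And>k. 1 \<le> k \<Longrightarrow> f k = g k) \<Longrightarrow> 1 \<le> j \<Longrightarrow> V f j = V g j"
  by (simp add: V_def)

lemma S_div_qnum:
  assumes "1 \<le> n"
  shows "S n f / qnum q n = S n (\<lambda>j. D j * V (\<lambda>k. f k / (D k * qnum q k)) j)"
proof -
  have "S n (\<lambda>j. D j * V (\<lambda>k. f k / (D k * qnum q k)) j)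
      = S n (\<lambda>j. (1 / qnum q j) * f j + D j * (1 + q ^ j) * (\<Sum>k=1..<j. 1 / (D k * qnum q k) * f k))"
    by (rule S_cong) (simp add: V_def distrib_left)
  also have "\<dots> = S n f / qnum q n"
  proof -
    have "B n k * (1 / qnum q k) + 1 / (D k * qnum q k) *
        (\<Sum>j=Suc k..n. B n j * (D j * (1 + q ^ j))) = B n k / qnum q n"
      if "k \<in> {1..n}" for k
      using that assms by (subst kernel_3[symmetric]) (auto simp: field_simps)
    then show ?thesis
      unfolding S_triangular unfolding S_def sum_divide_distrib by simp
  qed
  finally show ?thesis by simp
qed

text \<open>Between successive divisions the factors \<open>D k\<close> cancel and survive only at
  the two ends. Hence only the outer entries of a block are barred, and the inner ones carry
  \<open>\<theta>\<close>.\<close>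

primrec iter_V :: "nat \<Rightarrow> (nat \<Rightarrow> real) \<Rightarrow> nat \<Rightarrow> real" where
  "iter_V 0 f = (\<lambda>k. f k / (D k * qnum q k))"
| "iter_V (Suc m) f = (\<lambda>k. V (iter_V m f) k / qnum q k)"

lemma S_div_qnum_power:
  assumes "1 \<le> n"
  shows "S n f / qnum q n ^ Suc m = S n (\<lambda>j. D j * V (iter_V m f) j)"
proof (induction m)
  case 0
  then show ?case using S_div_qnum[OF assms] by simp
next
  case (Suc m)
  have "S n f / qnum q n ^ Suc (Suc m) = S n (\<lambda>j. D j * V (iter_V m f) j) / qnum q n"
    by (simp add: Suc[symmetric])
  also have "\<dots> = S n (\<lambda>j. D j * V (iter_V (Suc m) f) j)"
    by (subst S_div_qnum[OF assms]) simp
  finally show ?case .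
qed

lemma sum_S_ge_3:
  assumes "3 \<le> c"
  shows "(\<Sum>N=1..n. q ^ N / qnum q N ^ c * S N f)
     = S n (\<lambda>k. q ^ k / qnum q k ^ 2 * (D k * V (iter_V (c - 3) f) k))"
proof -
  \<comment> \<open>Two of the \<open>c\<close> factors \<open>1 / [N]\<close> are kept for
    \<open>sum_S_2\<close>; the other \<open>Suc (c - 3)\<close> go to
    \<open>S_div_qnum_power\<close>.\<close>
  have c: "c = Suc (c - 3) + 2"
    using assms by simp
  have "q ^ N / qnum q N ^ c * S N f
      = q ^ N / qnum q N ^ 2 * S N (\<lambda>k. D k * V (iter_V (c - 3) f) k)" if "N \<in> {1..n}" for N
    using that
    by (subst S_div_qnum_power[symmetric], simp) (subst c, simp only: power_add, simp)
  then have "(\<Sum>N=1..n. q ^ N / qnum q N ^ c * S N f)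
      = (\<Sum>N=1..n. q ^ N / qnum q N ^ 2 * S N (\<lambda>k. D k * V (iter_V (c - 3) f) k))"
    by (rule sum.cong[OF refl])
  then show ?thesis
    by (simp only: sum_S_2)
qed

section \<open>Sums over mergings as a recursion\<close>

definition W :: "signed \<times> nat \<times> zth \<Rightarrow> nat \<Rightarrow> real" where
  "W e k = (case e of (x, y, z) \<Rightarrow>
     ssgn x ^ k * q ^ (y * k) * q powi Qexp z k / qnum q k ^ sabs x)"

fun star :: "signed \<times> nat \<times> zth \<Rightarrow> signed \<times> nat \<times> zth \<Rightarrow> signed \<times> nat \<times> zth" where
  "star (x, y, z) (x', y', z') = (oplus x x', y + y', boxplus z z')"

lemma star_proj:
  "fst (star e f) = oplus (fst e) (fst f)"
  "(fst \<circ> snd) (star e f) = (fst \<circ> snd) e + (fst \<circ> snd) f"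
  "(snd \<circ> snd) (star e f) = boxplus ((snd \<circ> snd) e) ((snd \<circ> snd) f)"
  by (cases e; cases f; simp)+

text \<open>The sum over all gap choices of the terms with largest index \<open>k\<close>, without
  \<open>B n k\<close>; the first gap is a merge in the first summand and a comma in the second.
  \<open>W\<close> omits \<open>1 + q^k\<close>, which a merged run carries only once.\<close>

fun G :: "(signed \<times> nat \<times> zth) list \<Rightarrow> nat \<Rightarrow> real" where
  "G [] k = 0"
| "G [e] k = (1 + q ^ k) * W e k"
| "G (e # f # L) k = G (star e f # L) k + (1 + q ^ k) * W e k * (\<Sum>j=1..<k. G (f # L) j)"

fun chain :: "(signed \<times> nat \<times> zth) list \<Rightarrow> nat \<Rightarrow> real" where
  "chain [] n = 1"
| "chain (e # L) n = (\<Sum>k=1..n. (1 + q ^ k) * W e k * chain L (k - 1))"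

lemma chain_eq:
  "(\<Sum>ks | length ks = length L \<and> set ks \<subseteq> {1..n} \<and> sorted_wrt (>) ks.
      \<Prod>j<length L. (1 + q ^ (ks ! j)) * W (L ! j) (ks ! j)) = chain L n"
proof (induction L arbitrary: n)
  case Nil
  have "{ks :: nat list. ks = [] \<and> set ks \<subseteq> {1..n} \<and> sorted_wrt (>) ks} = {[]}"
    by auto
  then show ?case
    by simp
next
  case (Cons e L)
  show ?case
    unfolding length_Cons
    by (subst sum_chain_Suc[where u = "\<lambda>k. k - 1"])
      (auto simp del: prod.lessThan_Suc simp add: prod.lessThan_Suc_shift sum_distrib_left[symmetric] Cons.IH[symmetric])
qed

lemma Hcal_eq:
  "Hcal q n (map fst (e # L)) (map (fst \<circ> snd) (e # L)) (map (snd \<circ> snd) (e # L))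
     = S n (\<lambda>k. (1 + q ^ k) * W e k * chain L (k - 1))"
proof -
  have W: "ssgn (map fst M ! j) ^ k
        * q powi (int (map (fst \<circ> snd) M ! j) * int k + Qexp (map (snd \<circ> snd) M ! j) k)
        * (1 + q ^ k) / qnum q k ^ sabs (map fst M ! j) = (1 + q ^ k) * W (M ! j) k"
    if "j < length M" for M j k
  proof -
    have "q powi (int y * int k) = q ^ (y * k)" for y
      by (metis of_nat_mult power_int_of_nat)
    then show ?thesis
      using that by (cases "M ! j") (simp add: W_def power_int_add)
  qed
  have "Hcal q n (map fst (e # L)) (map (fst \<circ> snd) (e # L)) (map (snd \<circ> snd) (e # L))
    = (\<Sum>ks | length ks = Suc (length L) \<and> set ks \<subseteq> {1..n} \<and> sorted_wrt (>) ks.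
        B n (ks ! 0) * (\<Prod>j<Suc (length L). (1 + q ^ (ks ! j)) * W ((e # L) ! j) (ks ! j)))"
    unfolding Hcal_def B_def length_map length_Cons
    by (rule sum.cong[OF refl], rule arg_cong2[where f = "(*)"], rule refl, rule prod.cong[OF refl], rule W) simp
  also have "\<dots> = S n (\<lambda>k. (1 + q ^ k) * W e k * chain L (k - 1))"
    unfolding S_def
    by (subst sum_chain_Suc[where u = "\<lambda>k. k - 1"])
      (auto simp del: prod.lessThan_Suc
        simp add: prod.lessThan_Suc_shift sum_distrib_left[symmetric] chain_eq[symmetric])
  finally show ?thesis .
qed

text \<open>The head is arbitrary in the induction because a merge replaces it by
  \<open>star e f\<close>; a comma leaves the other gaps to the sum over the next index
  \<open>j < k\<close>.\<close>

lemma sum_merge_chain: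
  "(\<Sum>cs | length cs = length L. case merge star cs (e # L) of f # M \<Rightarrow> (1 + q ^ k) * W f k * chain M (k - 1))
     = G (e # L) k"
proof (induction L arbitrary: e k)
  case (Cons f L)
  let ?T = "\<lambda>M k. case M of f # M \<Rightarrow> (1 + q ^ k) * W f k * chain M (k - 1)"
  have chain: "chain (merge star cs (f # L)) (k - 1) = (\<Sum>j=1..<k. ?T (merge star cs (f # L)) j)" for cs
  proof -
    obtain g M where "merge star cs (f # L) = g # M"
      using merge_nonempty[of "f # L" star cs] by (cases "merge star cs (f # L)") auto
    moreover have "{1..k - 1} = {1..<k}"
      by auto
    ultimately show ?thesis
      by simp
  qed
  have "(\<Sum>cs | length cs = length L. ?T (merge star (False # cs) (e # f # L)) k)
      = (1 + q ^ k) * W e k * (\<Sum>j=1..<k. \<Sum>cs | length cs = length L. ?T (merge star cs (f # L)) j)"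
    unfolding merge.simps if_False list.case chain by (subst sum.swap) (simp add: sum_distrib_left)
  then show ?case
    using Cons.IH[where e = "star e f" and k = k] Cons.IH[where e = f] by (simp add: sum_bool_lists_Suc)
qed simp

text \<open>Turns the right-hand side of the theorem into a transform, which can be built up entry
  by entry.\<close>

lemma sum_mergings:
  assumes "L \<noteq> []"
  shows "(\<Sum>(p, p', p'') \<in># mergings (map fst L) (map (fst \<circ> snd) L) (map (snd \<circ> snd) L). Hcal q n p p' p'')
       = S n (G L)"
proof -
  obtain e M where L: "L = e # M"
    using assms by (cases L) auto
  have Hcal: "Hcal q n (merge oplus cs (map fst L)) (merge (+) cs (map (fst \<circ> snd) L)) (merge boxplus cs (map (snd \<circ> snd) L))
      = S n (\<lambda>k. case merge star cs L of f # M \<Rightarrow> (1 + q ^ k) * W f k * chain M (k - 1))" for cs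
  proof -
    obtain f M where "merge star cs L = f # M"
      using merge_nonempty[OF assms, of star cs] by (cases "merge star cs L") auto
    then show ?thesis
      using Hcal_eq[of n f M]
      by (simp add: map_merge[symmetric, where f = star] star_proj[unfolded o_def] o_def)
  qed
  have "(\<Sum>(p, p', p'') \<in># mergings (map fst L) (map (fst \<circ> snd) L) (map (snd \<circ> snd) L). Hcal q n p p' p'')
      = (\<Sum>cs | length cs = length M. S n (\<lambda>k. case merge star cs L of f # M \<Rightarrow> (1 + q ^ k) * W f k * chain M (k - 1)))"
    unfolding mergings_def sum_unfold_sum_mset Hcal[symmetric] by (simp add: multiset.map_comp o_def L)
  also have "\<dots> = S n (G L)"
    unfolding S_def by (subst sum.swap) (simp add: sum_distrib_left[symmetric] L sum_merge_chain)
  finally show ?thesis .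
qed

section \<open>Rescaling the first entry\<close>

lemma q_powi_Qexp:
  "q powi Qexp Th k = 1"
  "q powi Qexp (Z 2) k = q ^ (2 * tri k)"
  "q powi Qexp (Z 1) k = q ^ tri k"
  "q powi Qexp (Z 0) k = 1 / q ^ k"
  "q powi Qexp (Z (-1)) k = 1 / (q ^ tri k * q ^ k)"
proof -
  have "q powi (2 * int (tri k)) = q ^ (2 * tri k)"
    by (metis of_nat_mult of_nat_numeral power_int_of_nat)
  then show "q powi Qexp (Z 2) k = q ^ (2 * tri k)"
    by (simp only: Qexp_values)
  show "q powi Qexp (Z 1) k = q ^ tri k" "q powi Qexp (Z 0) k = 1 / q ^ k"
    "q powi Qexp (Z (-1)) k = 1 / (q ^ tri k * q ^ k)"
    by (simp_all only: Qexp_values) (simp_all add: power_int_minus power_int_diff field_simps)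
qed simp

text \<open>This is what \<open>\<theta>\<close> is for. The exponent contains \<open>- k\<close> at
  \<open>i = 0\<close> but not at \<open>i = 1\<close> or \<open>i = 2\<close>; telling
  \<open>\<theta>\<close> from \<open>Z 0\<close> keeps these apart, so merging in \<open>z\<close>
  changes the exponent by 0, \<open>tri k\<close> or \<open>- tri k\<close> whatever
  \<open>i\<close> is.\<close>

lemma W_star:
  assumes "z = Th \<or> z = Z (if b then - 1 else 1)" "i \<in> {0..2}"
  shows "W (star (x, y, st b i) (x', y', z)) k
       = W (x, y, st b i) k * (ssgn x' ^ k * q ^ (y' * k) / qnum q k ^ sabs x'
           * (case z of Th \<Rightarrow> 1 | Z r \<Rightarrow> q powi (r * int (tri k))))"
proof -
  have "ssgn (oplus x x') = ssgn x * ssgn x'" "sabs (oplus x x') = sabs x + sabs x'"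
    by (cases x; cases x'; simp)+
  moreover have "q powi Qexp (boxplus (st b i) z) k
      = q powi Qexp (st b i) k * (case z of Th \<Rightarrow> 1 | Z r \<Rightarrow> q powi (r * int (tri k)))"
  proof -
    consider "i = 0" | "i = 1" | "i = 2"
      using assms(2) by force
    then show ?thesis
      using assms(1)
      by cases (cases b; auto simp: q_powi_Qexp power_int_minus power_add mult_2 mult_2_right field_simps
          simp del: Qexp.simps)+
  qed
  ultimately show ?thesis
    by (simp add: W_def power_mult_distrib power_add add_mult_distrib)
qed

text \<open>By \<open>W_star\<close> later merges multiply both heads by the same factor, so their
  ratio persists in every term. As \<open>i\<close> and \<open>i'\<close> may differ, the third
  component of a head can be changed this way.\<close>

lemma G_scale:
  assumes "alternating b (map (snd \<circ> snd) L)" "i \<in> {0..2}" "i' \<in> {0..2}"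
    and "\<And>k. 1 \<le> k \<Longrightarrow> W (x', y', st b i') k = v k * W (x, y, st b i) k"
    and "1 \<le> k"
  shows "G ((x', y', st b i') # L) k = v k * G ((x, y, st b i) # L) k"
  using assms
proof (induction L arbitrary: b x y x' y')
  case (Cons f L)
  obtain p r z where f: "f = (p, r, z)"
    by (cases f)
  \<comment> \<open>\<open>\<theta>\<close> keeps the expected integer, an integer flips it.\<close>
  define b' where "b' = (if z = Th then b else \<not> b)"
  have z: "z = Th \<or> z = Z (if b then - 1 else 1)"
    using Cons.prems(1) by (cases z) (simp_all add: f)
  have alt: "alternating b' (map (snd \<circ> snd) L)"
    using Cons.prems(1) by (cases z) (simp_all add: f b'_def o_def)
  have st: "boxplus (st b j) z = st b' j" if "j \<in> {0..2}" for j
    using z that by (cases b; auto simp: b'_def)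
  have "G (star (x', y', st b i') f # L) k = v k * G (star (x, y, st b i) f # L) k"
  proof -
    have "W (oplus x' p, y' + r, st b' i') j = v j * W (oplus x p, y + r, st b' i) j" if "1 \<le> j" for j
      using W_star[OF z Cons.prems(2), of x y p r j] W_star[OF z Cons.prems(3), of x' y' p r j]
        Cons.prems(4)[OF that] Cons.prems(2,3)
      by (simp add: st)
    from Cons.IH[OF alt Cons.prems(2,3) this Cons.prems(5)] show ?thesis
      using Cons.prems(2,3) by (simp add: f st)
  qed
  then show ?case
    using Cons.prems(4,5) by (simp add: distrib_left)
qed simp

section \<open>Prepending entries to a star sum\<close>

lemma Hstar_Nil: "Hstar q n [] = 1"
proof -
  have "{ks :: nat list. ks = [] \<and> set ks \<subseteq> {1..n} \<and> sorted_wrt (\<ge>) ks} = {[]}"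
    by auto
  then show ?thesis
    by (simp add: Hstar_def)
qed

lemma Hstar_Cons: "Hstar q n (Plain c # s) = (\<Sum>k=1..n. q ^ k / qnum q k ^ c * Hstar q k s)"
  unfolding Hstar_def length_Cons
  by (subst sum_chain_Suc[where u = "\<lambda>k. k"])
    (auto simp del: prod.lessThan_Suc simp add: prod.lessThan_Suc_shift sum_distrib_left)

text \<open>Each 2 multiplies the transform by \<open>q^k / [k]^2\<close>, and
  \<open>G_scale\<close> absorbs the power into the head.\<close>

lemma Hstar_prepend_2s:
  assumes "\<And>n. Hstar q n s = S n (G ((x, y, st b i) # L))"
    and "alternating b (map (snd \<circ> snd) L)" "i \<in> {0..2}"
  shows "Hstar q n (replicate m (Plain 2) @ s) = S n (G ((oplus x (Plain (2 * m)), y + m, st b i) # L))"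
proof -
  have "Hstar q n (replicate m (Plain 2) @ s)
      = S n (\<lambda>k. (q ^ k / qnum q k ^ 2) ^ m * G ((x, y, st b i) # L) k)"
  proof (induction m arbitrary: n)
    case 0
    then show ?case
      using assms(1) by simp
  next
    case (Suc m)
    show ?case
      by (simp only: replicate_Suc append_Cons Hstar_Cons Suc sum_S_2 power_Suc mult.assoc)
  qed
  also have "\<dots> = S n (G ((oplus x (Plain (2 * m)), y + m, st b i) # L))"
  proof (rule S_cong, rule G_scale[OF assms(2,3,3), symmetric])
    fix k :: nat
    show "W (oplus x (Plain (2 * m)), y + m, st b i) k
        = (q ^ k / qnum q k ^ 2) ^ m * W (x, y, st b i) k"
      by (cases x) (simp_all add: W_def power_add power_divide add_mult_distrib
          power_mult[symmetric] mult_ac add_mult_distrib2)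
  qed
  finally show ?thesis .
qed

lemma Hstar_1: "Hstar q n [Plain 1] = S n (G [(Plain 1, 1, Z 2)])"
proof -
  have "Hstar q n [Plain 1] = (\<Sum>N=1..n. q ^ N / qnum q N)"
    by (simp add: Hstar_Cons Hstar_Nil)
  also have "\<dots> = S n (G [(Plain 1, 1, Z 2)])"
    unfolding sum_1 by (rule S_cong) (simp add: W_def q_powi_Qexp power_add del: Qexp.simps)
  finally show ?thesis .
qed

lemma Hstar_prepend_1:
  assumes "\<And>n. Hstar q n s = S n (G ((Bar p, y, Z 1) # L))"
    and alt: "alternating False (map (snd \<circ> snd) L)"
  shows "Hstar q n (Plain 1 # s) = S n (G ((Plain 1, 1, Z 2) # (Bar p, y, Z (-1)) # L))"
proof -
  let ?f = "G ((Bar p, y, Z 1) # L)"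
  \<comment> \<open>The diagonal of \<open>sum_S_1\<close>: merging \<open>Z 2\<close> with
    \<open>Z (-1)\<close> gives \<open>Z 1 = st False 2\<close> again.\<close>
  have merged: "G ((Bar (p + 1), y + 1, Z 1) # L) k = q ^ k / qnum q k * ?f k" if "1 \<le> k" for k
    using G_scale[OF alt, of 2 2 "Bar (p + 1)" "y + 1" "\<lambda>k. q ^ k / qnum q k" "Bar p" y k] that
    by (simp add: W_def power_add add_mult_distrib)
  \<comment> \<open>The off-diagonal part: the division takes the exponent \<open>tri k\<close> of
    \<open>Z 1\<close> to \<open>- tri k - k\<close>, that of \<open>Z (-1)\<close>, so
    \<open>i\<close> drops from 2 to 0.\<close>
  have sep: "G ((Bar p, y, Z (-1)) # L) k = ?f k / q ^ (2 * tri k + k)" if "1 \<le> k" for k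
    using G_scale[OF alt, of 2 0 "Bar p" y "\<lambda>k. 1 / q ^ (2 * tri k + k)" "Bar p" y k] that
    by (simp add: W_def q_powi_Qexp power_add mult_2 mult_2_right del: Qexp.simps)
  have "Hstar q n (Plain 1 # s) = (\<Sum>N=1..n. q ^ N / qnum q N * S N ?f)"
    by (simp add: Hstar_Cons assms(1))
  also have "\<dots> = S n (G ((Plain 1, 1, Z 2) # (Bar p, y, Z (-1)) # L))"
    unfolding sum_S_1
    by (rule S_cong)
      (use merged in \<open>simp add: sep W_def q_powi_Qexp power_add add.commute del: Qexp.simps\<close>)
  finally show ?thesis .
qed

text \<open>\<open>iter_V\<close> builds the block from the right: its start bars the old head, each
  further step adds an entry with \<open>\<theta>\<close>, and the final \<open>D k * V\<close> with
  \<open>sum_S_2\<close> adds \<open>(Bar 2, 1, Z 1)\<close>.\<close>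

lemma Hstar_prepend_ge_3:
  assumes "\<And>n. Hstar q n s = S n (G ((Plain p, y, Z 2) # L))"
    and alt: "alternating True (map (snd \<circ> snd) L)"
    and "3 \<le> c"
  shows "Hstar q n (Plain c # s)
       = S n (G ((Bar 2, 1, Z 1) # replicate (c - 3) (Plain 1, 0, Th) @ (Bar (p + 1), y, Z 1) # L))"
proof -
  let ?f = "G ((Plain p, y, Z 2) # L)"
  let ?M = "\<lambda>m. replicate m (Plain 1, 0, Th) @ (Bar (p + 1), y, Z 1) # L"
  have alt_M: "alternating False (map (snd \<circ> snd) (?M m))" for m
    using alt by (induction m) simp_all
  have absorb: "G ((Plain 1, 0, Th) # ?M m) k = V (G (?M m)) k / qnum q k
      \<and> G ((Bar 2, 1, Z 1) # ?M m) k = q ^ k / qnum q k ^ 2 * (D k * V (G (?M m)) k)"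
    if "1 \<le> k" for k m
  \<comment> \<open>The first merge meets the barred entry if \<open>m = 0\<close>, otherwise an
    entry with \<open>\<theta>\<close>.\<close>
  proof (cases m)
    case 0
    have "G ((Bar (p + 2), y, Z 1) # L) k = 1 / qnum q k * G ((Bar (p + 1), y, Z 1) # L) k"
      using G_scale[OF alt, of 1 1 "Bar (p + 2)" y "\<lambda>k. 1 / qnum q k" "Bar (p + 1)" y k] that
      by (simp add: W_def)
    \<comment> \<open>The leading \<open>Z 1\<close> counts as \<open>st False 2\<close>; merged
      with the next \<open>Z 1\<close> it gives \<open>Z 2 = st True 2\<close>.\<close>
    moreover have "G ((Plain (p + 3), y + 1, Z 2) # L) k
        = q ^ k / qnum q k ^ 2 * D k * G ((Bar (p + 1), y, Z 1) # L) k"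
      using G_scale[OF alt, of 1 2 "Plain (p + 3)" "y + 1" "\<lambda>k. q ^ k / qnum q k ^ 2 * D k" "Bar (p + 1)" y k] that
      by (simp add: W_def D_def q_powi_Qexp power_add mult_2 mult_2_right eval_nat_numeral field_simps del: Qexp.simps)
    ultimately show ?thesis
      using that unfolding 0
      by (simp add: V_def W_def D_def q_powi_Qexp eval_nat_numeral field_simps del: Qexp.simps)
  next
    case (Suc m')
    have "G ((Plain 2, 0, Th) # ?M m') k = 1 / qnum q k * G ((Plain 1, 0, Th) # ?M m') k"
      using G_scale[OF alt_M, of 1 1 "Plain 2" 0 "\<lambda>k. 1 / qnum q k" "Plain 1" 0 k m'] that
      by (simp add: W_def eval_nat_numeral)
    moreover have "G ((Bar 3, 1, Z 1) # ?M m') k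
        = q ^ k / qnum q k ^ 2 * D k * G ((Plain 1, 0, Th) # ?M m') k"
      using G_scale[OF alt_M, of 1 2 "Bar 3" 1 "\<lambda>k. q ^ k / qnum q k ^ 2 * D k" "Plain 1" 0 k m'] that
      by (simp add: W_def D_def q_powi_Qexp eval_nat_numeral field_simps del: Qexp.simps)
    ultimately show ?thesis
      using that unfolding Suc
      by (simp add: V_def W_def D_def q_powi_Qexp eval_nat_numeral field_simps del: Qexp.simps)
  qed
  have G_M: "G (?M m) k = iter_V m ?f k" if "1 \<le> k" for k m
    using that
  proof (induction m arbitrary: k)
    case 0
    \<comment> \<open>Division by \<open>D k\<close> lowers the exponent \<open>2 * tri k\<close> of
      \<open>Z 2\<close> to that of \<open>Z 1\<close>, so \<open>i\<close> goes from 2 to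
      1.\<close>
    then show ?case
      using G_scale[OF alt, of 2 1 "Bar (p + 1)" y "\<lambda>k. 1 / (D k * qnum q k)" "Plain p" y k]
      by (simp add: W_def D_def q_powi_Qexp power_add mult_2 mult_2_right field_simps del: Qexp.simps)
  next
    case (Suc m)
    then show ?case
      using absorb[of k m] V_cong[of "G (?M m)" "iter_V m ?f" k] by simp
  qed
  have "Hstar q n (Plain c # s) = (\<Sum>N=1..n. q ^ N / qnum q N ^ c * S N ?f)"
    by (simp add: Hstar_Cons assms(1))
  also have "\<dots> = S n (G ((Bar 2, 1, Z 1) # ?M (c - 3)))"
    unfolding sum_S_ge_3[OF assms(3)]
    using absorb V_cong[OF G_M] by (intro S_cong) simp
  finally show ?thesis .
qed

section \<open>Assembling the blocks\<close>

lemma Hstar_prepend_block: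
  assumes "\<And>n. Hstar q n (replicate a (Plain 2) @ Plain 1 # s) = S n (G ((Plain (2 * a + 1), a + 1, Z 2) # L))"
    and alt: "alternating True (map (snd \<circ> snd) L)"
    and "3 \<le> c"
  shows "Hstar q n (sblock b c a @ s) = S n (G (triples 1 (b, c, a) @ L))"
proof -
  have "alternating False (map (snd \<circ> snd) (replicate m (Plain 1, 0, Th) @ (Bar p, y, Z 1) # L))" for m p y
    using alt by (induction m) simp_all
  from Hstar_prepend_2s[of "Plain c # replicate a (Plain 2) @ Plain 1 # s" "Bar 2" 1 False 2, OF _ this, of "c - 3" "2 * a + 2" "a + 1" n b]
  show ?thesis
    using Hstar_prepend_ge_3[OF assms] by (simp add: sblock_def triples_def add.commute)
qed

text \<open>Blocks are added from the right. The \<open>{2}^a, 1\<close> closing a block belongs to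
  the hypothesis for the later blocks, so \<open>a\<close> is arbitrary; the rest of the block is
  added with leading \<open>Z 1\<close>, which the 1 in front then turns into
  \<open>Z (-1)\<close>.\<close>

lemma Hstar_B:
  assumes "\<forall>(b, c, a) \<in> set bs. 3 \<le> c"
  shows "Hstar q n (replicate a (Plain 2) @ Plain 1 # concat (map (\<lambda>(b, c, a). sblock b c a) bs))
       = S n (G ((Plain (2 * a + 1), a + 1, Z 2) # concat (map (triples (-1)) bs)))"
  using assms
proof (induction bs arbitrary: a n)
  case Nil
  show ?case
    using Hstar_prepend_2s[of "[Plain 1]" "Plain 1" 1 True 2 "[]" n a] Hstar_1 by (simp add: add.commute del: G.simps)
next
  case (Cons t bs)
  obtain b c a' where t: "t = (b, c, a')"
    by (cases t)
  let ?L = "concat (map (triples (-1)) bs)"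
  have "Hstar q n (sblock b c a' @ concat (map (\<lambda>(b, c, a). sblock b c a) bs)) = S n (G (triples 1 t @ ?L))" for n
    unfolding t by (rule Hstar_prepend_block[OF Cons.IH alternating_triples]) (use Cons.prems t in auto)
  then have "Hstar q n (Plain 1 # sblock b c a' @ concat (map (\<lambda>(b, c, a). sblock b c a) bs))
      = S n (G ((Plain 1, 1, Z 2) # triples (-1) t @ ?L))" for n
    using Hstar_prepend_1[of "sblock b c a' @ concat (map (\<lambda>(b, c, a). sblock b c a) bs)"
        "2 * b + 2" "b + 1" "replicate (c - 3) (Plain 1, 0, Th) @ (Bar (2 * a' + 2), a' + 1, Z 1) # ?L" n]
      alternating_triples[of "t # bs"]
    by (simp add: t triples_def)
  then show ?case
    using Hstar_prepend_2s[of "Plain 1 # sblock b c a' @ concat (map (\<lambda>(b, c, a). sblock b c a) bs)"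
        "Plain 1" 1 True 2 "triples (-1) t @ ?L" n a] alternating_triples[of "t # bs"]
    by (simp add: t add.commute)
qed

text \<open>The step of \<open>Hstar_B\<close> stopped before a 1 is put in front, so the first
  block keeps its \<open>Z 1\<close>.\<close>

lemma Hstar_A:
  assumes "\<forall>(b, c, a) \<in> set (t # bs). 3 \<le> c"
  shows "Hstar q n (concat (map (\<lambda>(b, c, a). sblock b c a) (t # bs)))
       = S n (G (triples 1 t @ concat (map (triples (-1)) bs)))"
proof -
  obtain b c a where t: "t = (b, c, a)"
    by (cases t)
  show ?thesis
    using Hstar_prepend_block[OF Hstar_B alternating_triples, of bs c n b a] assms by (simp add: t)
qed

end

theorem theorem6p4:
  fixes q :: real and n l :: nat and a b c :: "nat \<Rightarrow> nat"
  assumes "0 < q" and "q < 1" and "n \<ge> 1"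
    and "\<And>j. 1 \<le> j \<Longrightarrow> j \<le> l \<Longrightarrow> c j \<ge> 3"
  shows "(l \<ge> 1 \<longrightarrow> Hstar q n (sA l a b c) = (\<Sum>(p, p', p'') \<in># PiA l a b c. Hcal q n p p' p''))
       \<and> Hstar q n (sB l a b c) = (\<Sum>(p, p', p'') \<in># PiB l a b c. Hcal q n p p' p'')"
proof -
  interpret unit_q q
    using assms by unfold_locales
  \<comment> \<open>In case (A) the first block has its own third string, and \<open>bs 2\<close>
    collects the others.\<close>
  define bs where "bs i = map (\<lambda>j. (b j, c j, a j)) [i..<l + 1]" for i
  have ge_3: "\<forall>(b, c, a) \<in> set (bs 1). 3 \<le> c"
    using assms(4) by (auto simp: bs_def)
  have s: "concat (map (\<lambda>j. sblock (b j) (c j) (a j)) [1..<l + 1])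
      = concat (map (\<lambda>(b, c, a). sblock b c a) (bs 1))"
    by (simp add: bs_def o_def del: upt_Suc)
  have proj: "map fst (concat (map (triples r) (bs i))) = concat (map (\<lambda>j. xblock (b j) (c j) (a j)) [i..<l + 1])"
      "map (fst \<circ> snd) (concat (map (triples r) (bs i))) = concat (map (\<lambda>j. yblock (b j) (c j) (a j)) [i..<l + 1])"
      "map (snd \<circ> snd) (concat (map (triples r) (bs i))) = concat (map (\<lambda>j. zblock r (c j)) [i..<l + 1])" for r i
    by (simp_all add: bs_def map_concat o_def triples_proj[unfolded o_def] del: upt_Suc)
  have "Hstar q n (sA l a b c) = (\<Sum>(p, p', p'') \<in># PiA l a b c. Hcal q n p p' p'')" if "1 \<le> l"
  proof -
    have upt: "[1..<l + 1] = 1 # [2..<l + 1]"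
      using that by (simp add: upt_conv_Cons numeral_2_eq_2 del: upt_Suc)
    have bs: "bs 1 = (b 1, c 1, a 1) # bs 2"
      unfolding bs_def upt by simp
    let ?L = "triples 1 (b 1, c 1, a 1) @ concat (map (triples (-1)) (bs 2))"
    have "PiA l a b c = mergings (map fst ?L) (map (fst \<circ> snd) ?L) (map (snd \<circ> snd) ?L)"
      unfolding PiA_def upt by (simp only: map_append proj triples_proj list.map concat.simps)
    moreover have "Hstar q n (sA l a b c) = S n (G ?L)"
      unfolding sA_def s bs by (rule Hstar_A) (use ge_3 bs in simp)
    ultimately show ?thesis
      using sum_mergings[of ?L n] by (simp add: triples_def)
  qed
  moreover have "Hstar q n (sB l a b c) = (\<Sum>(p, p', p'') \<in># PiB l a b c. Hcal q n p p' p'')"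
  proof -
    let ?L = "(Plain (2 * a 0 + 1), a 0 + 1, Z 2) # concat (map (triples (-1)) (bs 1))"
    have "PiB l a b c = mergings (map fst ?L) (map (fst \<circ> snd) ?L) (map (snd \<circ> snd) ?L)"
      unfolding PiB_def list.map proj by simp
    moreover have "Hstar q n (sB l a b c) = S n (G ?L)"
      using Hstar_B[OF ge_3, of n "a 0"] unfolding sB_def s by simp
    ultimately show ?thesis
      using sum_mergings[of ?L n] by simp
  qed
  ultimately show ?thesis
    by blast
qed

end
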